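(* Let $G$ be a locally compact second countable group and $(X,\mu)$ a nonsingular $G$-space with Hopf decomposition $X=\mathcal{C}\sqcup\mathcal{D}$. The Hopf decomposition is determined by the following two properties: (1) every Borel subset of $\mathcal{C}$ is recurrent (equivalently, Haar-recurrent); (2) every $\mu$-positive Borel subset of $\mathcal{D}$ contains a $\mu$-positive transient (equivalently, Haar-transient) subset. That is, for each of the four combinations of a choice of "recurrent" or "Haar-recurrent" in (1) and of "transient" or "Haar-transient" in (2), the Hopf decomposition satisfies (1) and (2), and every decomposition of $X$ into two Borel sets satisfying (1) and (2) (in place of $\mathcal{C}$ and $\mathcal{D}$ respectively) coincides with the Hopf decomposition modulo $\mu$.
   Context: Fix a left Haar measure $\lambda$ on $G$. A Borel $G$-space is a standard Borel space $X$ with a Borel action map $G\times X\to X$, $(g,x)\mapsto g.x$. A nonsingular $G$-space is a Borel $G$-space $X$ with a $\sigma$-finite Borel measure $\mu$ such that $\mu\circ g\sim\mu$ for all $g\in G$, where $(\mu\circ g)(A)=\mu(g.A)$. Its Radon--Nikodym cocycle is a Borel map $\nabla:G\times X\to\mathbb{R}_{>0}$ satisfying $\nabla_e(x)=1$, $\nabla_{gh}(x)=\nabla_g(h.x)\nabla_h(x)$ for all $g,h,x$, and $\nabla_g=\frac{d\mu\circ g}{d\mu}$ $\mu$-a.e. for each $g$. $L^1_+(X,\mu)$ is the class of everywhere strictly positive functions in $L^1(X,\mu)$, and $S_f^G(x)=\int_G\nabla_g(x)f(g.x)\,d\lambda(g)$. The Hopf decomposition is the essentially unique decomposition $X=\mathcal{C}\sqcup\mathcal{D}$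 into $G$-invariant Borel sets such that for every $f\in L^1_+(X,\mu)$, modulo $\mu$, $\mathcal{C}=\{S_f^G=+\infty\}$ and $\mathcal{D}=\{S_f^G<+\infty\}$. A Borel set $A$ is $\mu$-positive if $\mu(A)>0$. For a Borel set $A\subseteq X$ and $x\in X$ let $R_A(x)=\{g\in G: x\in g.A\}$. A Borel set $A\subseteq X$ is: recurrent if $R_A(x)$ is not relatively compact for $\mu$-a.e. $x\in A$; Haar-recurrent if $\lambda(R_A(x))=+\infty$ for $\mu$-a.e. $x\in A$; transient if $R_A(x)$ is relatively compact for $\mu$-a.e. $x\in X$; Haar-transient if $\lambda(R_A(x))<+\infty$ for $\mu$-a.e. $x\in X$. *)

theory Defs
  imports "HOL-Analysis.Analysis"
begin

text \<open>
  Groups are types of class \<^class>\<open>topological_group_add\<close>. This class does not require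
  commutativity, so \<open>g + h\<close> is the product \<open>gh\<close>, \<open>0\<close> the unit and \<open>- g\<close> the inverse of a
  general topological group. As usual, locally compact groups are Hausdorff
  (class \<^class>\<open>t2_space\<close>).
\<close>

text \<open>
  No regularity is required below: on a locally compact second countable Hausdorff space every
  Borel measure that is finite on compact sets is regular.
\<close>

definition left_haar_measure ::
  "'g::{topological_group_add, t2_space, second_countable_topology} measure \<Rightarrow> bool"
  where "left_haar_measure \<eta> \<longleftrightarrow>
    sets \<eta> = sets borel \<and>
    emeasure \<eta> UNIV \<noteq> 0 \<and>
    (\<forall>K. compact K \<longrightarrow> emeasure \<eta> K < \<infinity>) \<and>
    (\<forall>g. \<forall>A\<in>sets borel. emeasure \<eta> ((\<lambda>h. g + h) ` A) = emeasure \<eta> A)"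

definition standard_borel_space :: "'x measure \<Rightarrow> bool"
  where "standard_borel_space M \<longleftrightarrow>
    (\<exists>T. completely_metrizable_space T \<and> second_countable T \<and> topspace T = space M \<and>
         sets M = sigma_sets (space M) {U. openin T U})"

locale borel_G_space =
  fixes M :: "'x measure"
    and act :: "'g::{topological_group_add, t2_space, second_countable_topology} \<Rightarrow> 'x \<Rightarrow> 'x"
  assumes standard_borel: "standard_borel_space M"
    and measurable_act: "(\<lambda>(g, x). act g x) \<in> borel \<Otimes>\<^sub>M M \<rightarrow>\<^sub>M M"
    and act_zero: "x \<in> space M \<Longrightarrow> act 0 x = x"
    and act_add: "x \<in> space M \<Longrightarrow> act (g + h) x = act g (act h x)"

text \<open>The measure \<open>\<mu> \<circ> g\<close>, that is \<open>A \<mapsto> \<mu> (g.A)\<close>.\<close>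

definition translate_measure :: "'x measure \<Rightarrow> ('g \<Rightarrow> 'x \<Rightarrow> 'x) \<Rightarrow> 'g \<Rightarrow> 'x measure"
  where "translate_measure M act g =
    measure_of (space M) (sets M) (\<lambda>A. emeasure M (act g ` A))"

context borel_G_space
begin

lemma measurable_act_single: "act g \<in> M \<rightarrow>\<^sub>M M"
proof -
  have "(\<lambda>x. (\<lambda>(g, x). act g x) (g, x)) \<in> M \<rightarrow>\<^sub>M M"
    by (rule measurable_compose[OF _ measurable_act]) simp
  then show ?thesis by simp
qed

lemma act_image_eq_vimage:
  assumes "A \<in> sets M"
  shows "act g ` A = act (- g) -` A \<inter> space M"
proof -
  have A: "A \<subseteq> space M" using assms by (rule sets.sets_into_space)
  have s: "act h x \<in> space M" if "x \<in> space M" for h x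
    using measurable_space[OF measurable_act_single that] .
  have i: "act (- h) (act h x) = x" "act h (act (- h) x) = x" if "x \<in> space M" for h x
    using act_add[OF that, of "- h" h] act_add[OF that, of h "- h"] act_zero[OF that] by simp_all
  show ?thesis
  proof (intro equalityI subsetI)
    fix y assume "y \<in> act g ` A"
    then show "y \<in> act (- g) -` A \<inter> space M" using A s i by auto
  next
    fix y assume "y \<in> act (- g) -` A \<inter> space M"
    then show "y \<in> act g ` A" using i(2)[of y g] by (metis IntE image_eqI vimageE)
  qed
qed

lemma sets_act_image: "A \<in> sets M \<Longrightarrow> act g ` A \<in> sets M"
  using act_image_eq_vimage measurable_sets[OF measurable_act_single] by simp

lemma translate_measure_eq_distr: "translate_measure M act g = distr M M (act (- g))"
  unfolding translate_measure_def distr_def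
  by (rule measure_of_eq)
    (auto simp: act_image_eq_vimage sets.space_closed sets.sigma_sets_eq)

lemma sets_translate_measure: "sets (translate_measure M act g) = sets M"
  by (simp add: translate_measure_eq_distr)

lemma emeasure_translate_measure:
  "A \<in> sets M \<Longrightarrow> emeasure (translate_measure M act g) A = emeasure M (act g ` A)"
  by (simp add: translate_measure_eq_distr act_image_eq_vimage
      emeasure_distr[OF measurable_act_single])

end

locale nonsingular_G_space = borel_G_space M act + sigma_finite_measure M
  for M :: "'x measure"
    and act :: "'g::{topological_group_add, t2_space, second_countable_topology} \<Rightarrow> 'x \<Rightarrow> 'x" +
  assumes nonsingular:
    "absolutely_continuous M (translate_measure M act g)"
    "absolutely_continuous (translate_measure M act g) M"

definition radon_nikodym_cocycle ::
  "'x measure \<Rightarrow> ('g::{topological_group_add, t2_space, second_countable_topology} \<Rightarrow> 'x \<Rightarrow> 'x) \<Rightarrow>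
   ('g \<Rightarrow> 'x \<Rightarrow> real) \<Rightarrow> bool"
  where "radon_nikodym_cocycle M act nabla \<longleftrightarrow>
    (\<lambda>(g, x). nabla g x) \<in> borel_measurable (borel \<Otimes>\<^sub>M M) \<and>
    (\<forall>g. \<forall>x\<in>space M. nabla g x > 0) \<and>
    (\<forall>x\<in>space M. nabla 0 x = 1) \<and>
    (\<forall>g h. \<forall>x\<in>space M. nabla (g + h) x = nabla g (act h x) * nabla h x) \<and>
    (\<forall>g. AE x in M. ennreal (nabla g x) = RN_deriv M (translate_measure M act g) x)"

definition L1_pos :: "'x measure \<Rightarrow> ('x \<Rightarrow> real) set"
  where "L1_pos M = {f. integrable M f \<and> (\<forall>x\<in>space M. f x > 0)}"

definition hopf_sum ::
  "'g measure \<Rightarrow> ('g \<Rightarrow> 'x \<Rightarrow> 'x) \<Rightarrow> ('g \<Rightarrow> 'x \<Rightarrow> real) \<Rightarrow> ('x \<Rightarrow> real) \<Rightarrow> 'x \<Rightarrow> ennreal"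
  where "hopf_sum \<eta> act nabla f x = (\<integral>\<^sup>+ g. ennreal (nabla g x * f (act g x)) \<partial>\<eta>)"

definition borel_decomposition :: "'x measure \<Rightarrow> 'x set \<Rightarrow> 'x set \<Rightarrow> bool"
  where "borel_decomposition M C D \<longleftrightarrow>
    C \<in> sets M \<and> D \<in> sets M \<and> C \<inter> D = {} \<and> C \<union> D = space M"

definition hopf_decomposition ::
  "'g measure \<Rightarrow> 'x measure \<Rightarrow> ('g \<Rightarrow> 'x \<Rightarrow> 'x) \<Rightarrow> ('g \<Rightarrow> 'x \<Rightarrow> real) \<Rightarrow> 'x set \<Rightarrow> 'x set \<Rightarrow> bool"
  where "hopf_decomposition \<eta> M act nabla C D \<longleftrightarrow>
    borel_decomposition M C D \<and>
    (\<forall>g. act g ` C = C \<and> act g ` D = D) \<and>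
    (\<forall>f\<in>L1_pos M.
      (AE x in M. x \<in> C \<longleftrightarrow> hopf_sum \<eta> act nabla f x = \<infinity>) \<and>
      (AE x in M. x \<in> D \<longleftrightarrow> hopf_sum \<eta> act nabla f x < \<infinity>))"

definition return_set :: "('g \<Rightarrow> 'x \<Rightarrow> 'x) \<Rightarrow> 'x set \<Rightarrow> 'x \<Rightarrow> 'g set"
  where "return_set act A x = {g. x \<in> act g ` A}"

definition relatively_compact :: "'g::topological_space set \<Rightarrow> bool"
  where "relatively_compact S \<longleftrightarrow> compact (closure S)"

text \<open>
  The sets of exceptional points need not be Borel; \<open>AE\<close> only requires them to be contained in a
  Borel null set.
\<close>

definition recurrent ::
  "'x measure \<Rightarrow> ('g::topological_space \<Rightarrow> 'x \<Rightarrow> 'x) \<Rightarrow> 'x set \<Rightarrow> bool"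
  where "recurrent M act A \<longleftrightarrow>
    A \<in> sets M \<and> (AE x in M. x \<in> A \<longrightarrow> \<not> relatively_compact (return_set act A x))"

definition haar_recurrent ::
  "'g measure \<Rightarrow> 'x measure \<Rightarrow> ('g \<Rightarrow> 'x \<Rightarrow> 'x) \<Rightarrow> 'x set \<Rightarrow> bool"
  where "haar_recurrent \<eta> M act A \<longleftrightarrow>
    A \<in> sets M \<and> (AE x in M. x \<in> A \<longrightarrow> emeasure \<eta> (return_set act A x) = \<infinity>)"

definition transient ::
  "'x measure \<Rightarrow> ('g::topological_space \<Rightarrow> 'x \<Rightarrow> 'x) \<Rightarrow> 'x set \<Rightarrow> bool"
  where "transient M act A \<longleftrightarrow>
    A \<in> sets M \<and> (AE x in M. relatively_compact (return_set act A x))"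

definition haar_transient ::
  "'g measure \<Rightarrow> 'x measure \<Rightarrow> ('g \<Rightarrow> 'x \<Rightarrow> 'x) \<Rightarrow> 'x set \<Rightarrow> bool"
  where "haar_transient \<eta> M act A \<longleftrightarrow>
    A \<in> sets M \<and> (AE x in M. emeasure \<eta> (return_set act A x) < \<infinity>)"

definition all_subsets_recurrent :: "'x measure \<Rightarrow> ('x set \<Rightarrow> bool) \<Rightarrow> 'x set \<Rightarrow> bool"
  where "all_subsets_recurrent M rec C \<longleftrightarrow> (\<forall>A\<in>sets M. A \<subseteq> C \<longrightarrow> rec A)"

definition positive_subsets_contain_transient ::
  "'x measure \<Rightarrow> ('x set \<Rightarrow> bool) \<Rightarrow> 'x set \<Rightarrow> bool"
  where "positive_subsets_contain_transient M tra D \<longleftrightarrow>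
    (\<forall>A\<in>sets M. A \<subseteq> D \<and> emeasure M A > 0 \<longrightarrow>
      (\<exists>B\<in>sets M. B \<subseteq> A \<and> emeasure M B > 0 \<and> tra B))"

end

theory Submission
  imports Defs
begin

text \<open>
  Write \<open>R\<^sub>B(x) = {g. x \<in> g.B}\<close> and \<open>S\<^sub>f\<close> for the Hopf integral of a positive integrable \<open>f\<close>.
  Everything rests on one identity (lemma \<open>nn_integral_hopf_sum\<close>), which follows from Fubini and
  the defining property of the Radon-Nikodym cocycle:
  \<open>\<integral>\<^sub>B S\<^sub>f d\<mu> = \<integral> f(y) \<eta>(R\<^sub>B(y)) d\<mu>(y)\<close>.

  Recurrence in the conservative part: if return sets \<open>R\<^sub>B\<close> have measure at most \<open>n\<close> on \<open>B\<close>, then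
  they have measure at most \<open>n\<close> everywhere, because \<open>R\<^sub>B(g.x) = g + R\<^sub>B(x)\<close> and \<open>\<eta>\<close> is left
  invariant. By the identity \<open>S\<^sub>f\<close> is then integrable over \<open>B\<close>, so \<open>B\<close> meets the
  conservative part in a null set.

  Transience in the dissipative part: a positive set on which \<open>S\<^sub>f < \<infinity>\<close> has a positive subset \<open>B\<close>
  with \<open>S\<^sub>f \<le> n\<cdot>f\<close>, and the identity, read from left to right, gives \<open>\<eta>(R\<^sub>B) < \<infinity>\<close> almost
  everywhere. To pass from finite measure to relative compactness, fix a compact neighbourhood \<open>K\<close>
  of the unit. Almost every \<open>x \<in> B\<close> has \<open>\<eta>(R\<^sub>B(x) \<inter> K) > 0\<close> (lemma \<open>AE_haar_return_set_pos\<close>),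
  so for small \<open>\<epsilon>\<close> the set \<open>B'\<close> of those \<open>x \<in> B\<close> for which this measure is at least \<open>\<epsilon>\<close> is
  positive. If \<open>g \<in> R\<^bsub>B'\<^esub>(x)\<close>, then \<open>R\<^sub>B(x)\<close> has measure at least \<open>\<epsilon>\<close> in \<open>g + K\<close>; since
  \<open>\<eta>(R\<^sub>B(x)) < \<infinity>\<close>, only finitely many such translates can be disjoint, which confines
  \<open>R\<^bsub>B'\<^esub>(x)\<close> to a compact set (lemma \<open>relatively_compact_if_translates_thick\<close>).

  Haar-recurrence implies recurrence and transience implies Haar-transience, because compact sets
  have finite measure. So the stronger form of each property holds for the Hopf decomposition,
  and this also gives uniqueness: a positive set common to the conservative part of one
  decomposition and the dissipative part of another would contain a positive set that is both
  recurrent and transient, or both Haar-recurrent and Haar-transient.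
\<close>

section \<open>Haar measure on a locally compact second countable group\<close>

locale lcsc_group =
  fixes \<eta> :: "'g::{topological_group_add, t2_space, second_countable_topology} measure"
  assumes locally_compact: "locally_compact_space (euclidean :: 'g topology)"
    and haar: "left_haar_measure \<eta>"
begin

lemma sets_haar: "sets \<eta> = sets borel"
  and space_haar: "space \<eta> = UNIV"
  using haar sets_eq_imp_space_eq[of \<eta> borel] by (auto simp: left_haar_measure_def)

lemma haar_translate: "A \<in> sets borel \<Longrightarrow> emeasure \<eta> ((+) g ` A) = emeasure \<eta> A"
  using haar by (simp add: left_haar_measure_def)

lemma haar_compact_finite: "compact K \<Longrightarrow> emeasure \<eta> K < \<infinity>"
  using haar by (simp add: left_haar_measure_def)

lemma compact_neighbourhood_obtains:
  obtains U K :: "'g set" where "open U" "compact K" "x \<in> U" "U \<subseteq> K"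
proof -
  have "\<exists>U K. open U \<and> compact K \<and> x \<in> U \<and> U \<subseteq> K"
    using locally_compact unfolding locally_compact_space_def by simp
  then show ?thesis
    using that by blast
qed

lemma open_translate:
  fixes V :: "'g set"
  assumes "open V"
  shows "open ((+) g ` V)"
proof -
  have "(+) g ` V = (\<lambda>x. - g + x) -` V"
    by (force simp: image_iff add.assoc[symmetric])
  moreover have "continuous_on UNIV (\<lambda>x. - g + x)"
    by (intro continuous_intros)
  ultimately show ?thesis
    using assms by (simp add: open_vimage)
qed

lemma sigma_finite_haar: "sigma_finite_measure \<eta>"
proof -
  define F where "F = {U :: 'g set. open U \<and> emeasure \<eta> U \<noteq> \<infinity>}"
  obtain F' where F': "F' \<subseteq> F" "countable F'" "\<Union>F' = \<Union>F"
    by (rule Lindelof[of F]) (auto simp: F_def)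
  have "x \<in> \<Union>F" for x
  proof -
    obtain U K :: "'g set" where UK: "open U" "compact K" "x \<in> U" "U \<subseteq> K"
      by (rule compact_neighbourhood_obtains)
    have "emeasure \<eta> U \<le> emeasure \<eta> K"
      using UK by (intro emeasure_mono) (auto simp: sets_haar compact_imp_closed)
    with haar_compact_finite[OF UK(2)] have "U \<in> F"
      using UK by (auto simp: F_def top_unique)
    with UK show ?thesis by auto
  qed
  then have "\<Union>F' = UNIV"
    using F' by auto
  with F' show ?thesis
    by (intro sigma_finite_measure.intro exI[of _ F'])
      (auto simp: F_def sets_haar space_haar)
qed

text \<open>Countably many translates of a nonempty open set cover the group, so a null one would make
  the whole group null.\<close>

lemma haar_open_pos:
  assumes "open V" "x \<in> V"
  shows "emeasure \<eta> V > 0"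
proof (rule ccontr)
  assume "\<not> emeasure \<eta> V > 0"
  then have V0: "emeasure \<eta> V = 0" by simp
  define F where "F = range (\<lambda>g. (+) g ` V)"
  have "open W" if "W \<in> F" for W
    using that open_translate[OF assms(1)] unfolding F_def by blast
  then obtain F' where F': "F' \<subseteq> F" "countable F'" "\<Union>F' = \<Union>F"
    using Lindelof[of F] by metis
  have "y \<in> \<Union>F" for y
  proof -
    have "y = (y - x) + x" by simp
    then have "y \<in> (+) (y - x) ` V" using assms(2) by (rule image_eqI)
    then show ?thesis by (auto simp only: F_def)
  qed
  moreover have "W \<in> null_sets \<eta>" if "W \<in> F'" for W
    using that F'(1) assms(1) V0 haar_translate[of V]
    by (auto simp: F_def sets_haar open_translate intro!: null_setsI)
  then have "\<Union>F' \<in> null_sets \<eta>"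
    using null_sets_UN'[OF F'(2), of "\<lambda>W. W" \<eta>] by simp
  ultimately have "UNIV \<in> null_sets \<eta>"
    using F'(3) by (metis UNIV_eq_I)
  then show False
    using haar by (auto simp: left_haar_measure_def null_sets_def)
qed

text \<open>Each translate of \<open>K\<close> by a point of \<open>S\<close> takes at least \<open>\<epsilon>\<close> of the finite measure of \<open>R\<close>, so
  the pairwise disjoint ones number at most \<open>\<eta>(R) / \<epsilon>\<close>. For a maximal disjoint family, every point
  of \<open>S\<close> lies in one of the finitely many compact sets \<open>g + K - K\<close>.\<close>

lemma relatively_compact_if_translates_thick:
  assumes K: "compact K" and R: "R \<in> sets borel" "emeasure \<eta> R < \<infinity>"
    and e: "\<epsilon> > (0::ennreal)"
    and thick: "\<And>g. g \<in> S \<Longrightarrow> \<epsilon> \<le> emeasure \<eta> (R \<inter> (+) g ` K)"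
  shows "relatively_compact S"
proof -
  have comp_trans: "compact ((+) g ` K)" for g
    by (intro compact_continuous_image continuous_intros K)
  then have K_sets: "(+) g ` K \<in> sets borel" for g
    by (simp add: compact_imp_closed)
  define P where "P F \<longleftrightarrow> finite F \<and> F \<subseteq> S \<and> disjoint_family_on (\<lambda>g. (+) g ` K) F" for F
  have bound: "of_nat (card F) * \<epsilon> \<le> emeasure \<eta> R" if "P F" for F
  proof -
    have "of_nat (card F) * \<epsilon> = (\<Sum>g\<in>F. \<epsilon>)" by simp
    also have "\<dots> \<le> (\<Sum>g\<in>F. emeasure \<eta> (R \<inter> (+) g ` K))"
      using that by (intro sum_mono thick) (auto simp: P_def)
    also have "\<dots> = emeasure \<eta> (\<Union>g\<in>F. R \<inter> (+) g ` K)"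
    proof (intro sum_emeasure)
      show "disjoint_family_on (\<lambda>g. R \<inter> (+) g ` K) F"
        using that unfolding P_def disjoint_family_on_def by blast
    qed (use that R K_sets in \<open>auto simp: P_def sets_haar\<close>)
    also have "\<dots> \<le> emeasure \<eta> R"
      using R by (intro emeasure_mono) (auto simp: sets_haar)
    finally show ?thesis .
  qed
  have "\<exists>b. \<forall>F. P F \<longrightarrow> card F < b"
  proof (cases "\<epsilon> = \<infinity>")
    case True
    have "card F < 1" if "P F" for F
      using bound[OF that] R(2) True by (cases "card F = 0") (auto simp: top_unique ennreal_mult_top)
    then show ?thesis by blast
  next
    case False
    obtain r where r: "emeasure \<eta> R = ennreal r" "r \<ge> 0"
      using R(2) by (cases "emeasure \<eta> R") auto
    obtain d where d: "\<epsilon> = ennreal d" "d > 0"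
      using e False by (cases \<epsilon>) auto
    have "card F < nat \<lceil>r / d\<rceil> + 1" if "P F" for F
    proof -
      have "ennreal (real (card F) * d) \<le> ennreal r"
        using bound[OF that] r d by (simp add: ennreal_mult' ennreal_of_nat_eq_real_of_nat)
      then have "real (card F) * d \<le> r"
        using r by (simp add: ennreal_le_iff)
      then have "real (card F) \<le> r / d"
        using d by (simp add: field_simps)
      then show ?thesis by linarith
    qed
    then show ?thesis by blast
  qed
  then obtain b where "\<forall>F. P F \<longrightarrow> card F < b" ..
  then obtain F where F: "P F" and F_max: "\<And>F'. P F' \<Longrightarrow> card F' \<le> card F"
    using ex_has_greatest_nat[of P "{}" card b] by (auto simp: P_def disjoint_family_on_def)
  define Q where "Q = (\<Union>g\<in>F. (\<lambda>(k, l). g + k - l) ` (K \<times> K))"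
  have "continuous_on (K \<times> K) (\<lambda>p. g + fst p + - snd p)" for g
    by (intro continuous_intros)
  then have "compact ((\<lambda>(k, l). g + k - l) ` (K \<times> K))" for g
    unfolding case_prod_unfold by (intro compact_continuous_image compact_Times K) simp
  then have "compact Q"
    unfolding Q_def using F by (intro compact_UN) (simp_all add: P_def)
  moreover have "S \<subseteq> Q"
  proof
    fix s assume s: "s \<in> S"
    have K_ne: "K \<noteq> {}"
      using thick[OF s] e by auto
    have "\<exists>g\<in>F. (+) g ` K \<inter> (+) s ` K \<noteq> {}"
    proof (rule ccontr)
      assume "\<not> ?thesis"
      then have disj: "\<forall>g\<in>F. (+) g ` K \<inter> (+) s ` K = {}" by blast
      then have "s \<notin> F" using K_ne by blast
      moreover from this have "P (insert s F)"
        using F s disj unfolding P_def by (subst disjoint_family_on_insert) blast+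
      ultimately show False
        using F_max[of "insert s F"] F by (auto simp: P_def)
    qed
    then obtain g k l where "g \<in> F" "k \<in> K" "l \<in> K" "g + k = s + l" by auto
    moreover from this have "s = g + k - l" by (simp add: eq_diff_eq)
    ultimately show "s \<in> Q"
      unfolding Q_def by (auto intro!: bexI[of _ g] image_eqI[of _ _ "(k, l)"])
  qed
  ultimately have "closure S = Q \<inter> closure S" "compact (Q \<inter> closure S)"
    using closure_minimal[of S Q] by (auto simp: compact_imp_closed intro: compact_Int_closed)
  then show ?thesis
    unfolding relatively_compact_def by metis
qed

lemma haar_finite_if_relatively_compact:
  assumes "relatively_compact S"
  shows "emeasure \<eta> S < \<infinity>"
proof -
  have "emeasure \<eta> S \<le> emeasure \<eta> (closure S)"
    by (intro emeasure_mono closure_subset) (simp add: sets_haar)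
  then show ?thesis
    using haar_compact_finite assms by (auto simp: relatively_compact_def intro: le_less_trans)
qed

end

section \<open>Return sets and the Hopf integral\<close>

locale lcsc_nonsingular_G_space = lcsc_group \<eta> + nonsingular_G_space M act
  for \<eta> :: "'g::{topological_group_add, t2_space, second_countable_topology} measure"
    and M :: "'x measure"
    and act :: "'g \<Rightarrow> 'x \<Rightarrow> 'x"
begin

sublocale haar_product: pair_sigma_finite \<eta> M
  using sigma_finite_haar sigma_finite_measure_axioms by (rule pair_sigma_finite.intro)

lemma act_space: "x \<in> space M \<Longrightarrow> act g x \<in> space M"
  by (rule measurable_space[OF measurable_act_single])

lemma act_cancel:
  assumes "x \<in> space M"
  shows "act (- g) (act g x) = x" "act g (act (- g) x) = x"
  using act_add[OF assms, of "- g" g] act_add[OF assms, of g "- g"] act_zero[OF assms] by simp_all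

lemma mem_return_set:
  assumes "A \<in> sets M" "x \<in> space M"
  shows "g \<in> return_set act A x \<longleftrightarrow> act (- g) x \<in> A"
  using act_image_eq_vimage[OF assms(1), of g] assms(2) by (simp add: return_set_def)

lemma return_set_mono: "A \<subseteq> B \<Longrightarrow> return_set act A x \<subseteq> return_set act B x"
  by (auto simp: return_set_def)

lemma return_set_act:
  assumes A: "A \<in> sets M" and x: "x \<in> space M"
  shows "return_set act A (act g x) = (+) g ` return_set act A x"
proof (intro equalityI subsetI)
  fix h assume "h \<in> return_set act A (act g x)"
  then have "act (- h) (act g x) \<in> A"
    using A x by (simp add: mem_return_set act_space)
  then have "act (- (- g + h)) x \<in> A"
    using x by (simp add: act_add[symmetric] minus_add)
  then have "- g + h \<in> return_set act A x"
    using A x by (simp add: mem_return_set)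
  moreover have "h = g + (- g + h)"
    by (simp add: add.assoc[symmetric])
  ultimately show "h \<in> (+) g ` return_set act A x" by blast
next
  fix h assume "h \<in> (+) g ` return_set act A x"
  then obtain k where k: "act (- k) x \<in> A" "h = g + k"
    using A x by (auto simp: mem_return_set)
  then have "act (- h) (act g x) = act (- k) (act (- g) (act g x))"
    using x by (simp add: minus_add act_add act_space del: add_uminus_conv_diff)
  then show "h \<in> return_set act A (act g x)"
    using A x k by (simp add: mem_return_set act_space act_cancel)
qed

lemma measurable_act_pair [measurable]: "(\<lambda>p. act (fst p) (snd p)) \<in> \<eta> \<Otimes>\<^sub>M M \<rightarrow>\<^sub>M M"
  using measurable_act
  by (simp add: case_prod_unfold sets_haar cong: measurable_cong_sets sets_pair_measure_cong)

lemma measurable_act_inverse_pair [measurable]: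
  "(\<lambda>p. act (- fst p) (snd p)) \<in> \<eta> \<Otimes>\<^sub>M M \<rightarrow>\<^sub>M M"
proof -
  have "continuous_on UNIV (uminus :: 'g \<Rightarrow> 'g)"
    by (intro continuous_intros)
  then have "(uminus :: 'g \<Rightarrow> 'g) \<in> \<eta> \<rightarrow>\<^sub>M \<eta>"
    using borel_measurable_continuous_onI[of "uminus :: 'g \<Rightarrow> 'g"]
    by (simp add: sets_haar cong: measurable_cong_sets)
  then have "(\<lambda>p. (- fst p, snd p)) \<in> \<eta> \<Otimes>\<^sub>M M \<rightarrow>\<^sub>M \<eta> \<Otimes>\<^sub>M M"
    by (intro measurable_Pair measurable_compose[OF measurable_fst]) simp_all
  from measurable_compose[OF this measurable_act_pair] show ?thesis by simp
qed

lemma sets_return_graph: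
  assumes "B \<in> sets M" "V \<in> sets borel"
  shows "{p \<in> space (\<eta> \<Otimes>\<^sub>M M). fst p \<in> V \<and> act (- fst p) (snd p) \<in> B} \<in> sets (\<eta> \<Otimes>\<^sub>M M)"
proof -
  have [measurable]: "B \<in> sets M" "V \<in> sets \<eta>"
    using assms by (simp_all add: sets_haar)
  show ?thesis by measurable
qed

lemma return_set_section:
  assumes "B \<in> sets M" "x \<in> space M"
  shows "return_set act B x \<inter> V =
    (\<lambda>g. (g, x)) -` {p \<in> space (\<eta> \<Otimes>\<^sub>M M). fst p \<in> V \<and> act (- fst p) (snd p) \<in> B}"
  using assms by (auto simp: mem_return_set space_pair_measure space_haar)

lemma sets_return_set:
  assumes "B \<in> sets M" "x \<in> space M"
  shows "return_set act B x \<in> sets borel"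
  using sets_Pair2[OF sets_return_graph[OF assms(1), of UNIV], of x]
    return_set_section[OF assms, of UNIV] by (simp add: sets_haar)

lemma measurable_haar_return_set:
  assumes "B \<in> sets M" "V \<in> sets borel"
  shows "(\<lambda>x. emeasure \<eta> (return_set act B x \<inter> V)) \<in> borel_measurable M"
  using haar_product.measurable_emeasure_Pair2[OF sets_return_graph[OF assms]]
  by (rule measurable_cong[THEN iffD1, rotated]) (simp add: return_set_section[OF assms(1)])

text \<open>Fubini for the indicator function of the pairs \<open>(g, x)\<close> with \<open>g \<in> V\<close> and \<open>x \<in> g.B\<close>, whose
  sections at \<open>x\<close> are the sets \<open>R\<^sub>B(x) \<inter> V\<close>.\<close>

lemma nn_integral_haar_return_set:
  assumes B: "B \<in> sets M" and V: "V \<in> sets borel" and u: "u \<in> borel_measurable M"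
  shows "(\<integral>\<^sup>+x. u x * emeasure \<eta> (return_set act B x \<inter> V) \<partial>M) =
    (\<integral>\<^sup>+g. indicator V g * (\<integral>\<^sup>+x. u x * indicator B (act (- g) x) \<partial>M) \<partial>\<eta>)"
proof -
  have [measurable]: "B \<in> sets M" "V \<in> sets \<eta>" "u \<in> borel_measurable M"
    using assms by (simp_all add: sets_haar)
  have meas: "(\<lambda>p. indicator V (fst p) * (u (snd p) * indicator B (act (- fst p) (snd p))) :: ennreal)
      \<in> borel_measurable (\<eta> \<Otimes>\<^sub>M M)"
    by measurable
  have "(\<integral>\<^sup>+x. u x * emeasure \<eta> (return_set act B x \<inter> V) \<partial>M) =
    (\<integral>\<^sup>+x. \<integral>\<^sup>+g. indicator V g * (u x * indicator B (act (- g) x)) \<partial>\<eta> \<partial>M)"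
  proof (rule nn_integral_cong)
    fix x assume x: "x \<in> space M"
    have "return_set act B x \<inter> V \<in> sets \<eta>"
      using sets_return_set[OF B x] V by (simp add: sets_haar)
    then have "u x * emeasure \<eta> (return_set act B x \<inter> V) =
        (\<integral>\<^sup>+g. u x * indicator (return_set act B x \<inter> V) g \<partial>\<eta>)"
      by (simp add: nn_integral_cmult)
    also have "\<dots> = (\<integral>\<^sup>+g. indicator V g * (u x * indicator B (act (- g) x)) \<partial>\<eta>)"
      by (intro nn_integral_cong) (simp add: indicator_def mem_return_set[OF B x])
    finally show "u x * emeasure \<eta> (return_set act B x \<inter> V) = \<dots>" .
  qed
  also have "\<dots> = (\<integral>\<^sup>+g. \<integral>\<^sup>+x. indicator V g * (u x * indicator B (act (- g) x)) \<partial>M \<partial>\<eta>)"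
    by (rule haar_product.Fubini') (use meas in \<open>simp add: case_prod_unfold\<close>)
  also have "\<dots> = (\<integral>\<^sup>+g. indicator V g * (\<integral>\<^sup>+x. u x * indicator B (act (- g) x) \<partial>M) \<partial>\<eta>)"
  proof (rule nn_integral_cong)
    fix g
    have [measurable]: "act (- g) \<in> M \<rightarrow>\<^sub>M M" by (rule measurable_act_single)
    show "(\<integral>\<^sup>+x. indicator V g * (u x * indicator B (act (- g) x)) \<partial>M) =
        indicator V g * (\<integral>\<^sup>+x. u x * indicator B (act (- g) x) \<partial>M)"
      by (rule nn_integral_cmult) measurable
  qed
  finally show ?thesis .
qed

text \<open>A nonempty \<open>R\<^sub>B(x)\<close> is a left translate of \<open>R\<^sub>B(z)\<close> for some \<open>z \<in> B\<close> on the orbit of \<open>x\<close>, so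
  left invariance carries the bound from \<open>B\<close> to the whole space.\<close>

lemma haar_return_set_bounded:
  assumes B: "B \<in> sets M" and bound: "\<And>z. z \<in> B \<Longrightarrow> emeasure \<eta> (return_set act B z) \<le> c"
    and x: "x \<in> space M"
  shows "emeasure \<eta> (return_set act B x) \<le> c"
proof (cases "return_set act B x = {}")
  case False
  then obtain g where g: "act (- g) x \<in> B"
    using B x by (auto simp: mem_return_set)
  have "return_set act B x = (+) g ` return_set act B (act (- g) x)"
    using return_set_act[OF B act_space[OF x], of g "- g"] x by (simp add: act_cancel)
  then show ?thesis
    using bound[OF g] haar_translate sets_return_set[OF B act_space[OF x]] by simp
qed simp

text \<open>Both sides are the integral of \<open>h\<close> against \<open>\<mu> \<circ> g\<close>, which has density \<open>\<nabla>\<^sub>g\<close> with respect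
  to \<open>\<mu>\<close> and is also the image of \<open>\<mu>\<close> under the action of \<open>- g\<close>.\<close>

lemma nn_integral_nabla:
  assumes "radon_nikodym_cocycle M act nabla" and h[measurable]: "h \<in> borel_measurable M"
  shows "(\<integral>\<^sup>+x. ennreal (nabla g x) * h x \<partial>M) = (\<integral>\<^sup>+x. h (act (- g) x) \<partial>M)"
proof -
  have RN: "AE x in M. ennreal (nabla g x) = RN_deriv M (translate_measure M act g) x"
    using assms(1) by (simp add: radon_nikodym_cocycle_def)
  have "(\<integral>\<^sup>+x. ennreal (nabla g x) * h x \<partial>M) =
      (\<integral>\<^sup>+x. RN_deriv M (translate_measure M act g) x * h x \<partial>M)"
    using RN by (intro nn_integral_cong_AE) auto
  also have "\<dots> = (\<integral>\<^sup>+x. h x \<partial>density M (RN_deriv M (translate_measure M act g)))"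
    by (simp add: nn_integral_density)
  also have "\<dots> = (\<integral>\<^sup>+x. h x \<partial>translate_measure M act g)"
    by (simp add: density_RN_deriv nonsingular sets_translate_measure)
  also have "\<dots> = (\<integral>\<^sup>+x. h (act (- g) x) \<partial>M)"
    by (simp add: translate_measure_eq_distr nn_integral_distr measurable_act_single)
  finally show ?thesis .
qed

lemma measurable_hopf_integrand:
  assumes nabla: "radon_nikodym_cocycle M act nabla" and f[measurable]: "f \<in> borel_measurable M"
  shows "(\<lambda>p. ennreal (nabla (fst p) (snd p) * f (act (fst p) (snd p))))
    \<in> borel_measurable (\<eta> \<Otimes>\<^sub>M M)"
proof -
  have [measurable]: "(\<lambda>p. nabla (fst p) (snd p)) \<in> borel_measurable (\<eta> \<Otimes>\<^sub>M M)"
    using nabla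
    by (simp add: radon_nikodym_cocycle_def case_prod_unfold sets_haar
        cong: measurable_cong_sets sets_pair_measure_cong)
  show ?thesis by measurable
qed

lemma measurable_hopf_sum:
  assumes "radon_nikodym_cocycle M act nabla" "f \<in> borel_measurable M"
  shows "hopf_sum \<eta> act nabla f \<in> borel_measurable M"
proof -
  have "(\<lambda>p. ennreal (nabla (snd p) (fst p) * f (act (snd p) (fst p))))
      \<in> borel_measurable (M \<Otimes>\<^sub>M \<eta>)"
    using measurable_compose[OF measurable_pair_swap' measurable_hopf_integrand[OF assms]]
    by (simp add: case_prod_unfold)
  then show ?thesis
    unfolding hopf_sum_def
    by (intro sigma_finite_measure.borel_measurable_nn_integral[OF sigma_finite_haar])
      (simp add: case_prod_unfold)
qed

text \<open>The bridge between the Hopf integral and return sets: the change of variable \<open>y = g.x\<close>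
  turns \<open>\<nabla>\<^sub>g(x) f(g.x)\<close> on \<open>B\<close> into \<open>f(y)\<close> on \<open>g.B\<close>, and \<open>y \<in> g.B\<close> means
  \<open>g \<in> R\<^sub>B(y)\<close>.\<close>

lemma nn_integral_hopf_sum:
  assumes nabla: "radon_nikodym_cocycle M act nabla" and f: "f \<in> L1_pos M" and B: "B \<in> sets M"
  shows "(\<integral>\<^sup>+x. indicator B x * hopf_sum \<eta> act nabla f x \<partial>M) =
    (\<integral>\<^sup>+x. ennreal (f x) * emeasure \<eta> (return_set act B x) \<partial>M)"
proof -
  have f_meas[measurable]: "f \<in> borel_measurable M" and f_pos: "\<And>x. x \<in> space M \<Longrightarrow> f x > 0"
    and B_meas[measurable]: "B \<in> sets M"
    using f B by (auto simp: L1_pos_def)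
  have act_meas[measurable]: "act g \<in> M \<rightarrow>\<^sub>M M" for g by (rule measurable_act_single)
  note [measurable] = measurable_hopf_integrand[OF nabla f_meas]
  have "(\<integral>\<^sup>+x. indicator B x * hopf_sum \<eta> act nabla f x \<partial>M) =
    (\<integral>\<^sup>+x. \<integral>\<^sup>+g. indicator B x * ennreal (nabla g x * f (act g x)) \<partial>\<eta> \<partial>M)"
  proof (rule nn_integral_cong)
    fix x assume x: "x \<in> space M"
    have "(\<lambda>g. ennreal (nabla g x * f (act g x))) \<in> borel_measurable \<eta>"
      using measurable_compose[OF measurable_Pair2' measurable_hopf_integrand[OF nabla f_meas]] x
      by simp
    then show "indicator B x * hopf_sum \<eta> act nabla f x =
        (\<integral>\<^sup>+g. indicator B x * ennreal (nabla g x * f (act g x)) \<partial>\<eta>)"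
      by (simp add: hopf_sum_def nn_integral_cmult)
  qed
  also have "\<dots> = (\<integral>\<^sup>+g. \<integral>\<^sup>+x. indicator B x * ennreal (nabla g x * f (act g x)) \<partial>M \<partial>\<eta>)"
    by (rule haar_product.Fubini') (simp add: case_prod_unfold)
  also have "\<dots> = (\<integral>\<^sup>+g. indicator UNIV g *
      (\<integral>\<^sup>+x. ennreal (f x) * indicator B (act (- g) x) \<partial>M) \<partial>\<eta>)"
  proof (rule nn_integral_cong)
    fix g
    have "(\<integral>\<^sup>+x. indicator B x * ennreal (nabla g x * f (act g x)) \<partial>M) =
        (\<integral>\<^sup>+x. ennreal (nabla g x) * (indicator B x * ennreal (f (act g x))) \<partial>M)"
      using f_pos act_space
      by (intro nn_integral_cong) (simp add: ennreal_mult'' less_imp_le ac_simps)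
    also have "\<dots> = (\<integral>\<^sup>+x. indicator B (act (- g) x) * ennreal (f (act g (act (- g) x))) \<partial>M)"
      by (rule nn_integral_nabla[OF nabla]) measurable
    also have "\<dots> = (\<integral>\<^sup>+x. ennreal (f x) * indicator B (act (- g) x) \<partial>M)"
      by (intro nn_integral_cong) (simp add: act_cancel ac_simps)
    finally show "(\<integral>\<^sup>+x. indicator B x * ennreal (nabla g x * f (act g x)) \<partial>M) =
        indicator UNIV g * (\<integral>\<^sup>+x. ennreal (f x) * indicator B (act (- g) x) \<partial>M)"
      by simp
  qed
  also have "\<dots> = (\<integral>\<^sup>+x. ennreal (f x) * emeasure \<eta> (return_set act B x) \<partial>M)"
    using nn_integral_haar_return_set[OF B, of UNIV "\<lambda>x. ennreal (f x)"] by simp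
  finally show ?thesis .
qed

end

section \<open>Recurrence in the conservative part, transience in the dissipative part\<close>

lemma positive_measure_level:
  fixes P :: "nat \<Rightarrow> 'a \<Rightarrow> bool"
  assumes A: "A \<in> sets M" "emeasure M A > 0" and meas: "\<And>n. {x \<in> A. P n x} \<in> sets M"
    and ex: "AE x in M. x \<in> A \<longrightarrow> (\<exists>n. P n x)"
  obtains n where "emeasure M {x \<in> A. P n x} > 0"
proof (rule ccontr)
  assume "\<not> thesis"
  then have "{x \<in> A. P n x} \<in> null_sets M" for n
    using that meas by (auto simp: null_sets_def zero_less_iff_neq_zero)
  then have "AE x in M. \<forall>n. x \<notin> {x \<in> A. P n x}"
    unfolding AE_all_countable using AE_not_in by blast
  with ex have "AE x in M. x \<notin> A" by eventually_elim auto
  with A show False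
    by (simp add: AE_iff_null_sets[symmetric] null_setsD1)
qed

lemma null_set_if_AE_contradictory:
  assumes "A \<in> sets M" "AE x in M. x \<in> A \<longrightarrow> P x" "AE x in M. x \<in> A \<longrightarrow> \<not> P x"
  shows "emeasure M A = 0"
proof -
  have "AE x in M. x \<notin> A"
    using assms(2,3) by eventually_elim auto
  with assms(1) show ?thesis
    by (simp add: AE_iff_null_sets[symmetric] null_setsD1)
qed

context lcsc_nonsingular_G_space
begin

text \<open>On the part \<open>B\<close> of \<open>A\<close> where return sets have measure at most \<open>n\<close>, the Hopf integral has
  total mass at most \<open>n\<close> times that of \<open>f\<close>, so it is almost everywhere finite there.\<close>

lemma haar_recurrent_if_hopf_sum_infinite:
  assumes nabla: "radon_nikodym_cocycle M act nabla" and f: "f \<in> L1_pos M" and A: "A \<in> sets M"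
    and inf: "AE x in M. x \<in> A \<longrightarrow> hopf_sum \<eta> act nabla f x = \<infinity>"
  shows "haar_recurrent \<eta> M act A"
proof -
  have f_meas[measurable]: "f \<in> borel_measurable M" and f_int: "integrable M f"
    and f_pos: "\<And>x. x \<in> space M \<Longrightarrow> f x > 0"
    using f by (auto simp: L1_pos_def)
  have [measurable]: "A \<in> sets M" by (rule A)
  have [measurable]: "(\<lambda>x. emeasure \<eta> (return_set act A x)) \<in> borel_measurable M"
    using measurable_haar_return_set[OF A, of UNIV] by simp
  have [measurable]: "hopf_sum \<eta> act nabla f \<in> borel_measurable M"
    by (rule measurable_hopf_sum[OF nabla f_meas])
  define B where "B n = {x \<in> A. emeasure \<eta> (return_set act A x) \<le> of_nat n}" for n :: nat
  have B_eq: "B n = {x \<in> space M. x \<in> A \<and> emeasure \<eta> (return_set act A x) \<le> of_nat n}" for n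
    using sets.sets_into_space[OF A] by (auto simp: B_def)
  have B_sets[measurable]: "B n \<in> sets M" for n
    unfolding B_eq by measurable
  have "AE x in M. x \<notin> B n" for n
  proof -
    have on_B: "emeasure \<eta> (return_set act (B n) x) \<le> of_nat n" if x: "x \<in> B n" for x
    proof -
      have "x \<in> space M" using x by (simp add: B_eq)
      then have "emeasure \<eta> (return_set act (B n) x) \<le> emeasure \<eta> (return_set act A x)"
        by (intro emeasure_mono return_set_mono) (auto simp: B_def sets_haar sets_return_set A)
      also have "\<dots> \<le> of_nat n" using x by (simp add: B_def)
      finally show ?thesis .
    qed
    have "(\<integral>\<^sup>+x. indicator (B n) x * hopf_sum \<eta> act nabla f x \<partial>M) =
        (\<integral>\<^sup>+x. ennreal (f x) * emeasure \<eta> (return_set act (B n) x) \<partial>M)"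
      by (rule nn_integral_hopf_sum[OF nabla f B_sets])
    also have "\<dots> \<le> (\<integral>\<^sup>+x. ennreal (f x) * of_nat n \<partial>M)"
      by (intro nn_integral_mono mult_left_mono haar_return_set_bounded[OF B_sets on_B]) auto
    also have "\<dots> = (\<integral>\<^sup>+x. ennreal (f x) \<partial>M) * of_nat n"
      by (rule nn_integral_multc) measurable
    also have "\<dots> < \<infinity>"
      using f_int f_pos by (simp add: nn_integral_eq_integral less_imp_le ennreal_mult_less_top
        of_nat_less_top)
    finally have "AE x in M. indicator (B n) x * hopf_sum \<eta> act nabla f x \<noteq> \<infinity>"
      by (intro nn_integral_PInf_AE) auto
    with inf show ?thesis
      by eventually_elim (auto simp: B_def)
  qed
  then have "AE x in M. \<forall>n. x \<notin> B n"
    unfolding AE_all_countable by blast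
  then have "AE x in M. x \<in> A \<longrightarrow> emeasure \<eta> (return_set act A x) = \<infinity>"
  proof eventually_elim
    case (elim x)
    show ?case
    proof (intro impI, rule ccontr)
      assume "x \<in> A" "emeasure \<eta> (return_set act A x) \<noteq> \<infinity>"
      moreover from this obtain n :: nat where "emeasure \<eta> (return_set act A x) < of_nat n"
        using ennreal_Ex_less_of_nat[of "emeasure \<eta> (return_set act A x)"]
        by (auto simp: less_top)
      ultimately show False
        using elim by (auto simp: B_def dest: less_imp_le)
    qed
  qed
  with A show ?thesis by (simp add: haar_recurrent_def)
qed

text \<open>The set of points of \<open>A\<close> where the Hopf integral of \<open>f\<close> is at most \<open>n\<cdot>f\<close> works for large
  \<open>n\<close>: there the integral has finite total mass, which equals the total mass of
  \<open>x \<mapsto> f(x) \<eta>(R(x))\<close>.\<close>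

lemma haar_transient_subset_if_hopf_sum_finite:
  assumes nabla: "radon_nikodym_cocycle M act nabla" and f: "f \<in> L1_pos M"
    and A: "A \<in> sets M" "emeasure M A > 0"
    and fin: "AE x in M. x \<in> A \<longrightarrow> hopf_sum \<eta> act nabla f x < \<infinity>"
  obtains B where "B \<in> sets M" "B \<subseteq> A" "emeasure M B > 0" "haar_transient \<eta> M act B"
proof -
  have f_meas[measurable]: "f \<in> borel_measurable M" and f_int: "integrable M f"
    and f_pos: "\<And>x. x \<in> space M \<Longrightarrow> f x > 0"
    using f by (auto simp: L1_pos_def)
  have [measurable]: "A \<in> sets M" by (rule A)
  have [measurable]: "hopf_sum \<eta> act nabla f \<in> borel_measurable M"
    by (rule measurable_hopf_sum[OF nabla f_meas])
  define B where "B n = {x \<in> A. hopf_sum \<eta> act nabla f x \<le> of_nat n * ennreal (f x)}" for n :: nat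
  have B_eq: "B n = {x \<in> space M. x \<in> A \<and> hopf_sum \<eta> act nabla f x \<le> of_nat n * ennreal (f x)}"
    for n
    using sets.sets_into_space[OF A(1)] by (auto simp: B_def)
  have B_sets[measurable]: "B n \<in> sets M" for n
    unfolding B_eq by measurable
  have ex: "AE x in M. x \<in> A \<longrightarrow>
      (\<exists>n::nat. hopf_sum \<eta> act nabla f x \<le> of_nat n * ennreal (f x))"
    using fin AE_space
  proof eventually_elim
    case (elim x)
    show ?case
    proof
      assume "x \<in> A"
      then obtain s where s: "hopf_sum \<eta> act nabla f x = ennreal s" "s \<ge> 0"
        using elim by (cases "hopf_sum \<eta> act nabla f x") auto
      obtain n :: nat where "s / f x < of_nat n"
        using reals_Archimedean2 by blast
      then have "s \<le> of_nat n * f x"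
        using f_pos[OF elim(2)] by (simp add: field_simps)
      then have "hopf_sum \<eta> act nabla f x \<le> of_nat n * ennreal (f x)"
        using f_pos[OF elim(2)] s
        by (simp add: ennreal_of_nat_eq_real_of_nat ennreal_mult'[symmetric] ennreal_leI)
      then show "\<exists>n::nat. hopf_sum \<eta> act nabla f x \<le> of_nat n * ennreal (f x)" ..
    qed
  qed
  obtain n where n: "emeasure M (B n) > 0"
    using positive_measure_level[OF A B_sets[unfolded B_def] ex] unfolding B_def by blast
  have "(\<integral>\<^sup>+x. ennreal (f x) * emeasure \<eta> (return_set act (B n) x) \<partial>M) =
      (\<integral>\<^sup>+x. indicator (B n) x * hopf_sum \<eta> act nabla f x \<partial>M)"
    by (rule nn_integral_hopf_sum[OF nabla f B_sets, symmetric])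
  also have "\<dots> \<le> (\<integral>\<^sup>+x. of_nat n * ennreal (f x) \<partial>M)"
    by (intro nn_integral_mono) (auto simp: B_def indicator_def)
  also have "\<dots> = of_nat n * (\<integral>\<^sup>+x. ennreal (f x) \<partial>M)"
    by (rule nn_integral_cmult) measurable
  also have "\<dots> < \<infinity>"
    using f_int f_pos by (simp add: nn_integral_eq_integral less_imp_le ennreal_mult_less_top
        of_nat_less_top)
  finally have fin_int: "(\<integral>\<^sup>+x. ennreal (f x) * emeasure \<eta> (return_set act (B n) x) \<partial>M) \<noteq> \<infinity>"
    by simp
  have [measurable]: "(\<lambda>x. emeasure \<eta> (return_set act (B n) x)) \<in> borel_measurable M"
    using measurable_haar_return_set[OF B_sets, of UNIV] by simp
  have "AE x in M. ennreal (f x) * emeasure \<eta> (return_set act (B n) x) \<noteq> \<infinity>"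
    by (rule nn_integral_PInf_AE[OF _ fin_int]) measurable
  then have "AE x in M. emeasure \<eta> (return_set act (B n) x) < \<infinity>"
    using AE_space
  proof eventually_elim
    case (elim x)
    then show ?case
      using f_pos[OF elim(2)] by (auto simp: ennreal_mult_eq_top_iff less_top)
  qed
  then have "haar_transient \<eta> M act (B n)"
    by (simp add: haar_transient_def B_sets)
  then show thesis
    using that[of "B n"] n B_sets by (auto simp: B_def)
qed

text \<open>Almost every point of \<open>B\<close> returns to \<open>B\<close> for a nonnull set of group elements near the unit.
  Let \<open>N\<close> be the set of exceptions and \<open>V\<close> a neighbourhood with \<open>- V + V \<subseteq> U\<close>. Translating by an
  element of \<open>R\<^sub>N(x) \<inter> V\<close>, if there is one, shows that \<open>R\<^sub>N(x) \<inter> V\<close> is null for every \<open>x\<close>, so by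
  Fubini \<open>g.N\<close> is null for almost every \<open>g \<in> V\<close>; one such \<open>g\<close> is enough, by nonsingularity.\<close>

lemma AE_haar_return_set_pos:
  assumes B: "B \<in> sets M" and U: "open U" "0 \<in> U"
  shows "AE x in M. x \<in> B \<longrightarrow> emeasure \<eta> (return_set act B x \<inter> U) > 0"
proof -
  have U_sets: "U \<in> sets borel" using U by simp
  have [measurable]: "B \<in> sets M" by (rule B)
  note [measurable] = measurable_haar_return_set[OF B U_sets]
  define N where "N = {x \<in> space M. x \<in> B \<and> emeasure \<eta> (return_set act B x \<inter> U) = 0}"
  have N_sets[measurable]: "N \<in> sets M"
    unfolding N_def by measurable
  have N_sub: "N \<subseteq> B" by (auto simp: N_def)
  have "open ((\<lambda>p. - fst p + snd p) -` U)"
    using U(1) by (intro open_vimage) (auto intro!: continuous_intros)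
  then obtain V1 V2 where V12: "open V1" "open V2" "(0 :: 'g, 0 :: 'g) \<in> V1 \<times> V2"
      "V1 \<times> V2 \<subseteq> (\<lambda>p. - fst p + snd p) -` U"
    using U(2) by (elim open_prod_elim) auto
  define V where "V = V1 \<inter> V2"
  have V: "open V" "0 \<in> V" "\<And>g h. g \<in> V \<Longrightarrow> h \<in> V \<Longrightarrow> - g + h \<in> U"
    using V12 by (auto simp: V_def)
  then have V_sets: "V \<in> sets borel" by simp
  have null: "emeasure \<eta> (return_set act N x \<inter> V) = 0" if x: "x \<in> space M" for x
  proof (cases "return_set act N x \<inter> V = {}")
    case False
    then obtain g where g: "act (- g) x \<in> N" "g \<in> V"
      using x by (auto simp: mem_return_set)
    define z where "z = act (- g) x"
    have z: "z \<in> space M" "x = act g z"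
      using x by (auto simp: z_def act_space act_cancel)
    have RU_sets: "return_set act B z \<inter> U \<in> sets borel"
      using sets_return_set[OF B z(1)] U_sets by simp
    have "return_set act N x \<inter> V \<subseteq> (+) g ` (return_set act B z \<inter> U)"
    proof
      fix h assume h: "h \<in> return_set act N x \<inter> V"
      then obtain k where k: "k \<in> return_set act N z" "h = g + k"
        using return_set_act[OF N_sets z(1), of g] z(2) by auto
      then have "- g + h = k" by (simp add: add.assoc[symmetric])
      then have "k \<in> U"
        using V(3)[OF g(2), of h] h by simp
      with k(1) have "k \<in> return_set act B z \<inter> U"
        using return_set_mono[OF N_sub] by blast
      with k(2) show "h \<in> (+) g ` (return_set act B z \<inter> U)"
        by (rule image_eqI)
    qed
    then have "emeasure \<eta> (return_set act N x \<inter> V) \<le> emeasure \<eta> ((+) g ` (return_set act B z \<inter> U))"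
    proof (rule emeasure_mono)
      have "(+) g ` (return_set act B z \<inter> U) = return_set act B x \<inter> (\<lambda>h. - g + h) -` U"
        unfolding z(2) return_set_act[OF B z(1)] by (force simp: image_iff add.assoc[symmetric])
      moreover have "open ((\<lambda>h. - g + h) -` U)"
        using U(1) by (intro open_vimage) (auto intro!: continuous_intros)
      ultimately show "(+) g ` (return_set act B z \<inter> U) \<in> sets \<eta>"
        using sets_return_set[OF B x] by (simp add: sets_haar)
    qed
    also have "\<dots> = 0"
      using g(1) haar_translate[OF RU_sets] by (simp add: N_def z_def)
    finally show ?thesis by simp
  qed simp
  have image_meas: "(\<lambda>g. emeasure M (act g ` N)) \<in> borel_measurable \<eta>"
  proof -
    have "act g ` N = Pair g -` {p \<in> space (\<eta> \<Otimes>\<^sub>M M). fst p \<in> UNIV \<and> act (- fst p) (snd p) \<in> N}"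
      for g
      by (auto simp: act_image_eq_vimage[OF N_sets] space_pair_measure space_haar)
    then show ?thesis
      using haar_product.measurable_emeasure_Pair1[OF sets_return_graph[OF N_sets, of UNIV]] by simp
  qed
  have "(\<integral>\<^sup>+g. indicator V g * emeasure M (act g ` N) \<partial>\<eta>) =
      (\<integral>\<^sup>+g. indicator V g * (\<integral>\<^sup>+x. 1 * indicator N (act (- g) x) \<partial>M) \<partial>\<eta>)"
  proof (rule nn_integral_cong)
    fix g
    have "(\<integral>\<^sup>+x. 1 * indicator N (act (- g) x) \<partial>M) = (\<integral>\<^sup>+x. indicator (act g ` N) x \<partial>M)"
      by (intro nn_integral_cong) (simp add: act_image_eq_vimage[OF N_sets] indicator_def)
    also have "\<dots> = emeasure M (act g ` N)"
      by (simp add: sets_act_image)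
    finally show "indicator V g * emeasure M (act g ` N) =
        indicator V g * (\<integral>\<^sup>+x. 1 * indicator N (act (- g) x) \<partial>M)"
      by simp
  qed
  also have "\<dots> = (\<integral>\<^sup>+x. 1 * emeasure \<eta> (return_set act N x \<inter> V) \<partial>M)"
    by (rule nn_integral_haar_return_set[OF N_sets V_sets, symmetric]) simp
  also have "\<dots> = (\<integral>\<^sup>+x. 0 \<partial>M)"
    by (intro nn_integral_cong) (simp add: null)
  finally have "(\<integral>\<^sup>+g. indicator V g * emeasure M (act g ` N) \<partial>\<eta>) = 0"
    by simp
  moreover have "(\<lambda>g. indicator V g * emeasure M (act g ` N)) \<in> borel_measurable \<eta>"
    using V_sets image_meas
    by (intro borel_measurable_times_ennreal borel_measurable_indicator) (simp_all add: sets_haar)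
  ultimately have "AE g in \<eta>. indicator V g * emeasure M (act g ` N) = 0"
    using nn_integral_0_iff_AE by blast
  then have AE_V: "AE g in \<eta>. g \<in> V \<longrightarrow> emeasure M (act g ` N) = 0"
    by eventually_elim auto
  have "\<exists>g\<in>V. emeasure M (act g ` N) = 0"
  proof (rule ccontr)
    assume "\<not> ?thesis"
    with AE_V have "emeasure \<eta> V = 0"
      using V_sets by (intro null_set_if_AE_contradictory[OF _ AE_V]) (auto simp: sets_haar)
    with haar_open_pos[OF V(1,2)] show False by simp
  qed
  then obtain g where "emeasure M (act g ` N) = 0" by blast
  then have "N \<in> null_sets (translate_measure M act g)"
    by (simp add: null_sets_def emeasure_translate_measure sets_translate_measure)
  then have "N \<in> null_sets M"
    using nonsingular(2)[of g] by (auto simp: absolutely_continuous_def)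
  then have "AE x in M. x \<notin> N" by (rule AE_not_in)
  then show ?thesis
    using AE_space by eventually_elim (auto simp: N_def zero_less_iff_neq_zero)
qed

text \<open>Keep those points of \<open>B\<close> whose near returns to \<open>B\<close> have measure at least \<open>\<epsilon>\<close>. Each return of an
  orbit to this smaller set contributes at least \<open>\<epsilon>\<close>, locally, to the finite measure of the
  returns to \<open>B\<close>, so only returns in a compact part of the group are possible.\<close>

lemma transient_subset_if_haar_transient:
  assumes B: "haar_transient \<eta> M act B" "emeasure M B > 0"
  obtains B' where "B' \<in> sets M" "B' \<subseteq> B" "emeasure M B' > 0" "transient M act B'"
proof -
  have B_sets[measurable]: "B \<in> sets M"
    and B_fin: "AE x in M. emeasure \<eta> (return_set act B x) < \<infinity>"
    using B by (auto simp: haar_transient_def)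
  obtain U K :: "'g set" where UK: "open U" "compact K" "0 \<in> U" "U \<subseteq> K"
    by (rule compact_neighbourhood_obtains)
  have K_sets: "K \<in> sets borel" using UK by (simp add: compact_imp_closed)
  note [measurable] = measurable_haar_return_set[OF B_sets K_sets]
  define \<epsilon> where "\<epsilon> n = ennreal (inverse (real (Suc n)))" for n
  define B' where "B' n = {x \<in> B. \<epsilon> n \<le> emeasure \<eta> (return_set act B x \<inter> K)}" for n
  have B'_eq: "B' n = {x \<in> space M. x \<in> B \<and> \<epsilon> n \<le> emeasure \<eta> (return_set act B x \<inter> K)}" for n
    using sets.sets_into_space[OF B_sets] by (auto simp: B'_def)
  have B'_sets: "B' n \<in> sets M" for n
    unfolding B'_eq by measurable
  have "AE x in M. x \<in> B \<longrightarrow> (\<exists>n. \<epsilon> n \<le> emeasure \<eta> (return_set act B x \<inter> K))"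
    using AE_haar_return_set_pos[OF B_sets UK(1,3)] AE_space
  proof eventually_elim
    case (elim x)
    show ?case
    proof
      assume "x \<in> B"
      moreover have "emeasure \<eta> (return_set act B x \<inter> U) \<le> emeasure \<eta> (return_set act B x \<inter> K)"
        using UK sets_return_set[OF B_sets elim(2)] K_sets
        by (intro emeasure_mono) (auto simp: sets_haar)
      ultimately have pos: "emeasure \<eta> (return_set act B x \<inter> K) > 0"
        using elim by auto
      show "\<exists>n. \<epsilon> n \<le> emeasure \<eta> (return_set act B x \<inter> K)"
      proof (cases "emeasure \<eta> (return_set act B x \<inter> K)")
        case (real r)
        then obtain n where "inverse (real (Suc n)) < r"
          using pos reals_Archimedean[of r] by auto
        then show ?thesis
          using real by (auto simp: \<epsilon>_def intro!: exI[of _ n] ennreal_leI)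
      qed simp
    qed
  qed
  from positive_measure_level[OF B_sets B(2) B'_sets[unfolded B'_def] this]
  obtain n where n: "emeasure M (B' n) > 0"
    unfolding B'_def by blast
  have "AE x in M. relatively_compact (return_set act (B' n) x)"
    using B_fin AE_space
  proof eventually_elim
    case (elim x)
    show ?case
    proof (rule relatively_compact_if_translates_thick[OF UK(2) sets_return_set[OF B_sets elim(2)] elim(1)])
      show "\<epsilon> n > 0" by (simp add: \<epsilon>_def)
      fix g assume "g \<in> return_set act (B' n) x"
      then have g: "act (- g) x \<in> B' n"
        using elim(2) by (simp add: mem_return_set B'_sets)
      define z where "z = act (- g) x"
      have z: "z \<in> space M" "x = act g z"
        using elim(2) by (auto simp: z_def act_space act_cancel)
      have "return_set act B x \<inter> (+) g ` K = (+) g ` (return_set act B z \<inter> K)"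
        unfolding z(2) return_set_act[OF B_sets z(1)] by auto
      then show "\<epsilon> n \<le> emeasure \<eta> (return_set act B x \<inter> (+) g ` K)"
        using g haar_translate[of "return_set act B z \<inter> K" g] sets_return_set[OF B_sets z(1)] K_sets
        by (simp add: B'_def z_def)
    qed
  qed
  then have "transient M act (B' n)"
    by (simp add: transient_def B'_sets)
  then show thesis
    using that[of "B' n"] n B'_sets by (auto simp: B'_def)
qed

lemma recurrent_if_haar_recurrent:
  assumes "haar_recurrent \<eta> M act A"
  shows "recurrent M act A"
proof -
  have "AE x in M. x \<in> A \<longrightarrow> \<not> relatively_compact (return_set act A x)"
    using assms unfolding haar_recurrent_def
    by (auto elim!: eventually_mono dest!: haar_finite_if_relatively_compact)
  with assms show ?thesis by (simp add: recurrent_def haar_recurrent_def)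
qed

lemma haar_transient_if_transient:
  assumes "transient M act A"
  shows "haar_transient \<eta> M act A"
proof -
  have "AE x in M. emeasure \<eta> (return_set act A x) < \<infinity>"
    using assms unfolding transient_def
    by (auto elim!: eventually_mono dest!: haar_finite_if_relatively_compact)
  with assms show ?thesis by (simp add: transient_def haar_transient_def)
qed

lemma recurrent_transient_null:
  assumes "recurrent M act A" "transient M act A"
  shows "emeasure M A = 0"
proof (rule null_set_if_AE_contradictory)
  show "AE x in M. x \<in> A \<longrightarrow> relatively_compact (return_set act A x)"
    using assms(2) by (auto simp: transient_def elim: eventually_mono)
qed (use assms(1) in \<open>auto simp: recurrent_def\<close>)

lemma haar_recurrent_haar_transient_null:
  assumes "haar_recurrent \<eta> M act A" "haar_transient \<eta> M act A"
  shows "emeasure M A = 0"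
proof (rule null_set_if_AE_contradictory)
  show "AE x in M. x \<in> A \<longrightarrow> \<not> emeasure \<eta> (return_set act A x) = \<infinity>"
    using assms(2) by (auto simp: haar_transient_def elim: eventually_mono)
qed (use assms(1) in \<open>auto simp: haar_recurrent_def\<close>)

lemma L1_pos_nonempty: "\<exists>f. f \<in> L1_pos M"
proof -
  obtain f :: "'x \<Rightarrow> real"
    where "f \<in> borel_measurable M" "\<And>x. f x > 0" "\<And>x. f x \<le> 1" "integrable M f"
    by (rule obtain_positive_integrable_function) blast
  then have "f \<in> L1_pos M" by (simp add: L1_pos_def)
  then show ?thesis by blast
qed

lemma hopf_conservative_haar_recurrent:
  assumes nabla: "radon_nikodym_cocycle M act nabla"
    and hopf: "hopf_decomposition \<eta> M act nabla C D"
  shows "all_subsets_recurrent M (haar_recurrent \<eta> M act) C"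
  unfolding all_subsets_recurrent_def
proof (intro ballI impI)
  fix A assume A: "A \<in> sets M" "A \<subseteq> C"
  obtain f where f: "f \<in> L1_pos M" using L1_pos_nonempty ..
  then have "AE x in M. x \<in> C \<longleftrightarrow> hopf_sum \<eta> act nabla f x = \<infinity>"
    using hopf by (simp add: hopf_decomposition_def)
  then have "AE x in M. x \<in> A \<longrightarrow> hopf_sum \<eta> act nabla f x = \<infinity>"
    by eventually_elim (use A in auto)
  then show "haar_recurrent \<eta> M act A"
    by (rule haar_recurrent_if_hopf_sum_infinite[OF nabla f A(1)])
qed

lemma hopf_dissipative_contains_transient:
  assumes nabla: "radon_nikodym_cocycle M act nabla"
    and hopf: "hopf_decomposition \<eta> M act nabla C D"
  shows "positive_subsets_contain_transient M (transient M act) D"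
  unfolding positive_subsets_contain_transient_def
proof (intro ballI impI)
  fix A assume A: "A \<in> sets M" "A \<subseteq> D \<and> emeasure M A > 0"
  obtain f where f: "f \<in> L1_pos M" using L1_pos_nonempty ..
  then have "AE x in M. x \<in> D \<longleftrightarrow> hopf_sum \<eta> act nabla f x < \<infinity>"
    using hopf by (simp add: hopf_decomposition_def)
  then have "AE x in M. x \<in> A \<longrightarrow> hopf_sum \<eta> act nabla f x < \<infinity>"
    by eventually_elim (use A in auto)
  then obtain B where B: "B \<subseteq> A" "emeasure M B > 0" "haar_transient \<eta> M act B"
    using haar_transient_subset_if_hopf_sum_finite[OF nabla f A(1)] A(2) by metis
  obtain B' where "B' \<in> sets M" "B' \<subseteq> B" "emeasure M B' > 0" "transient M act B'"
    using transient_subset_if_haar_transient[OF B(3,2)] by metis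
  with B(1) show "\<exists>B\<in>sets M. B \<subseteq> A \<and> emeasure M B > 0 \<and> transient M act B"
    by blast
qed

end

section \<open>The characterization of the Hopf decomposition\<close>

lemma disjoint_recurrent_dissipative:
  assumes "C \<in> sets M" "D \<in> sets M"
    and "all_subsets_recurrent M rec C" "positive_subsets_contain_transient M tra D"
    and excl: "\<And>A. rec A \<Longrightarrow> tra A \<Longrightarrow> emeasure M A = 0"
  shows "C \<inter> D \<in> null_sets M"
proof (rule ccontr)
  assume "C \<inter> D \<notin> null_sets M"
  then have "emeasure M (C \<inter> D) > 0"
    using assms(1,2) by (auto simp: null_sets_def zero_less_iff_neq_zero)
  then obtain B where "B \<in> sets M" "B \<subseteq> C \<inter> D" "emeasure M B > 0" "tra B"
    using assms(1,2,4) unfolding positive_subsets_contain_transient_def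
    by (metis Int_lower2 sets.Int)
  with assms(3) excl[of B] show False
    by (auto simp: all_subsets_recurrent_def)
qed

theorem theoremB:
  fixes \<eta> :: "'g::{topological_group_add, t2_space, second_countable_topology} measure"
    and M :: "'x measure"
    and act :: "'g \<Rightarrow> 'x \<Rightarrow> 'x"
    and nabla :: "'g \<Rightarrow> 'x \<Rightarrow> real"
    and C D :: "'x set"
  assumes "locally_compact_space (euclidean :: 'g topology)"
    and "left_haar_measure \<eta>"
    and "nonsingular_G_space M act"
    and "radon_nikodym_cocycle M act nabla"
    and "hopf_decomposition \<eta> M act nabla C D"
  shows "\<forall>rec\<in>{recurrent M act, haar_recurrent \<eta> M act}.
         \<forall>tra\<in>{transient M act, haar_transient \<eta> M act}.
           all_subsets_recurrent M rec C \<and>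
           positive_subsets_contain_transient M tra D \<and>
           (\<forall>C' D'. borel_decomposition M C' D' \<and>
                    all_subsets_recurrent M rec C' \<and>
                    positive_subsets_contain_transient M tra D' \<longrightarrow>
                    sym_diff C C' \<in> null_sets M \<and> sym_diff D D' \<in> null_sets M)"
proof -
  interpret nonsingular_G_space M act by fact
  interpret lcsc_nonsingular_G_space \<eta> M act
    using assms(1,2) by unfold_locales
  note strong_rec = hopf_conservative_haar_recurrent[OF assms(4,5)]
  note strong_tra = hopf_dissipative_contains_transient[OF assms(4,5)]
  have CD: "borel_decomposition M C D"
    using assms(5) by (simp add: hopf_decomposition_def)
  show ?thesis
  proof (intro ballI conjI allI impI)
    fix rec tra
    assume rec: "rec \<in> {recurrent M act, haar_recurrent \<eta> M act}"
      and tra: "tra \<in> {transient M act, haar_transient \<eta> M act}"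
    have rec_strength: "haar_recurrent \<eta> M act A \<Longrightarrow> rec A" "rec A \<Longrightarrow> recurrent M act A" for A
      using rec recurrent_if_haar_recurrent by auto
    have tra_strength: "transient M act A \<Longrightarrow> tra A" "tra A \<Longrightarrow> haar_transient \<eta> M act A" for A
      using tra haar_transient_if_transient by auto
    show "all_subsets_recurrent M rec C"
      using strong_rec rec_strength(1) by (auto simp: all_subsets_recurrent_def)
    show "positive_subsets_contain_transient M tra D"
      using strong_tra tra_strength(1) unfolding positive_subsets_contain_transient_def by meson
    fix C' D'
    assume *: "borel_decomposition M C' D' \<and> all_subsets_recurrent M rec C' \<and>
      positive_subsets_contain_transient M tra D'"
    \<comment> \<open>In each of the two mixed pairs, the strong property of the Hopf decomposition excludes the weak
      property of the other decomposition.\<close>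
    have "C \<inter> D' \<in> null_sets M"
      using * CD strong_rec tra_strength(2) haar_recurrent_haar_transient_null
      by (intro disjoint_recurrent_dissipative[where rec = "haar_recurrent \<eta> M act" and tra = tra])
        (auto simp: borel_decomposition_def)
    moreover have "C' \<inter> D \<in> null_sets M"
      using * CD strong_tra rec_strength(2) recurrent_transient_null
      by (intro disjoint_recurrent_dissipative[where rec = rec and tra = "transient M act"])
        (auto simp: borel_decomposition_def)
    ultimately have "(C \<inter> D') \<union> (C' \<inter> D) \<in> null_sets M"
      by (rule null_sets.Un)
    moreover have "sym_diff C C' = (C \<inter> D') \<union> (C' \<inter> D)" "sym_diff D D' = (C \<inter> D') \<union> (C' \<inter> D)"
      using * CD by (auto simp: borel_decomposition_def)
    ultimately show "sym_diff C C' \<in> null_sets M" "sym_diff D D' \<in> null_sets M"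
      by simp_all
  qed
qed

end
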